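(* Suppose that $f$ is holomorphic in a neighbourhood of $0$, that $f(0)=0$, and that $0<|f'(0)|<1$. Then the asymptotic representative $\mathcal{D}$ of $f$ at $0$ is smoothly conjugate, in a neighbourhood of $0$, to the map $z\mapsto f'(0)z$.
   Context: For $f$ with $f(0)=0$, let $\rho_f(r)=(|f(B(0,r))|/\pi)^{1/2}$ be the mean radius, where $|\cdot|$ is area. A generalized derivative of $f$ at $0$ is any locally uniform limit of $z\mapsto f(r_kz)/\rho_f(r_k)$ along a decreasing sequence $r_k\to0$. If there is exactly one generalized derivative $g$ (as is the case for non-constant holomorphic $f$), the asymptotic representative of $f$ at $0$ is $\mathcal{D}(z)=\rho_f(|z|)\,g(z/|z|)$ for $z\ne0$ and $\mathcal{D}(0)=0$. "Smoothly conjugate to $A$ in a neighbourhood of $0$" means that there is a $C^\infty$ diffeomorphism $H$ from a neighbourhood of $0$ onto a neighbourhood of $0$ with $H(0)=0$ and $H\circ\mathcal{D}=A\circ H$ near $0$. *)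

theory Defs
  imports "HOL-Complex_Analysis.Complex_Analysis"
begin

text \<open>
  All notions below depend only on the germ at \<open>0\<close> of the maps involved. A map defined in a
  neighbourhood of \<open>0\<close> is represented by a total function, whose values away from \<open>0\<close> are
  irrelevant.
\<close>

definition mean_radius :: "(complex \<Rightarrow> complex) \<Rightarrow> real \<Rightarrow> real" where
  "mean_radius f r = sqrt (measure lebesgue (f ` ball 0 r) / pi)"

text \<open>
  For every compact set \<open>K\<close> the points \<open>r k * z\<close> with \<open>z \<in> K\<close> eventually lie in the domain
  of \<open>f\<close>, so the limit is a map on the whole plane.
\<close>

definition generalized_derivative :: "(complex \<Rightarrow> complex) \<Rightarrow> (complex \<Rightarrow> complex) \<Rightarrow> bool" where
  "generalized_derivative f g \<longleftrightarrow>
     (\<exists>r :: nat \<Rightarrow> real. decseq r \<and> (\<forall>k. 0 < r k) \<and> r \<longlonglongrightarrow> 0 \<and>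
        (\<forall>z. \<exists>e>0. uniform_limit (ball z e)
           (\<lambda>k w. f (of_real (r k) * w) / of_real (mean_radius f (r k))) g sequentially))"

text \<open>Meaningful only if \<open>f\<close> has exactly one generalized derivative.\<close>

definition asymptotic_representative :: "(complex \<Rightarrow> complex) \<Rightarrow> complex \<Rightarrow> complex" where
  "asymptotic_representative f z =
     (if z = 0 then 0
      else of_real (mean_radius f (cmod z)) *
           (THE g. generalized_derivative f g) (z / of_real (cmod z)))"

text \<open>
  Real differentiability of class \<open>C\<^sup>k\<close> on an open set of a Euclidean space, by recursion on
  \<open>k\<close> through all directional derivatives. For maps of the complex plane this is smoothness
  as a map of \<open>\<real>\<^sup>2\<close>.
\<close>

primrec Ck_on :: "nat \<Rightarrow> 'a::euclidean_space set \<Rightarrow> ('a \<Rightarrow> 'b::euclidean_space) \<Rightarrow> bool" where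
  "Ck_on 0 S f \<longleftrightarrow> continuous_on S f"
| "Ck_on (Suc k) S f \<longleftrightarrow>
     (\<forall>x\<in>S. f differentiable (at x)) \<and>
     (\<forall>v. Ck_on k S (\<lambda>x. frechet_derivative f (at x) v))"

definition smooth_on :: "'a::euclidean_space set \<Rightarrow> ('a \<Rightarrow> 'b::euclidean_space) \<Rightarrow> bool" where
  "smooth_on S f \<longleftrightarrow> (\<forall>k. Ck_on k S f)"

definition smooth_diffeomorphism ::
    "'a::euclidean_space set \<Rightarrow> 'b::euclidean_space set \<Rightarrow> ('a \<Rightarrow> 'b) \<Rightarrow> bool" where
  "smooth_diffeomorphism U V H \<longleftrightarrow>
     open U \<and> open V \<and> bij_betw H U V \<and> smooth_on U H \<and> smooth_on V (inv_into U H)"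

text \<open>
  The clause \<open>D z \<in> U\<close> ensures that \<open>H (D z)\<close> is a value of \<open>H\<close> on its domain.
\<close>

definition smoothly_conjugate_near_0 ::
    "(complex \<Rightarrow> complex) \<Rightarrow> (complex \<Rightarrow> complex) \<Rightarrow> bool" where
  "smoothly_conjugate_near_0 D A \<longleftrightarrow>
     (\<exists>U V H. 0 \<in> U \<and> 0 \<in> V \<and> smooth_diffeomorphism U V H \<and> H 0 = 0 \<and>
        (\<forall>\<^sub>F z in nhds 0. z \<in> U \<and> D z \<in> U \<and> H (D z) = A (H z)))"

end

theory Submission
  imports Defs
begin

text \<open>
  Writing \<open>f' z = (\<Sum>k. b k * z ^ k)\<close>, the area of \<open>f (B(0,r))\<close> is the integral of
  \<open>(cmod (f' z))\<^sup>2\<close>, and the monomials are orthogonal on discs by rotation invariance. So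
  \<open>\<rho>(r)\<^sup>2 = P(r\<^sup>2)\<close> with \<open>P w = w * u w\<close> holomorphic near \<open>0\<close>, real on the reals, and
  \<open>u 0 = (cmod a)\<^sup>2\<close> for \<open>a = f' 0\<close>. The only generalized derivative is \<open>z \<mapsto> (a / cmod a) * z\<close>,
  whence \<open>\<D> z = a * z * v (z * cnj z)\<close> with \<open>v w = csqrt (u w) / cmod a\<close>, and
  \<open>\<D> z * cnj (\<D> z) = P (z * cnj z)\<close>. A conjugacy of the form \<open>H z = z * G (z * cnj z)\<close> to
  \<open>z \<mapsto> a * z\<close> therefore amounts to \<open>G w = v w * G (P w)\<close>, solved as in Koenigs' theorem by the
  infinite product of the \<open>v ((P ^^ n) w)\<close>. Since \<open>G\<close> is holomorphic, \<open>H\<close> is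
  smooth, and the inverse of \<open>H\<close> has the same shape.
\<close>

subsection \<open>Areas of holomorphic images\<close>

text \<open>The area formula applied below, \<open>measure_differentiable_image_eq\<close>, speaks
  of coordinate vectors and of \<open>det (matrix _)\<close>, so the plane is carried over to
  \<open>real^2\<close>.\<close>

definition plane_coords :: "complex \<Rightarrow> real^2" where
  "plane_coords z = vector [Re z, Im z]"

definition plane_point :: "real^2 \<Rightarrow> complex" where
  "plane_point x = Complex (x $ 1) (x $ 2)"

lemma plane_point_coords [simp]: "plane_point (plane_coords z) = z"
  by (simp add: plane_point_def plane_coords_def)

lemma plane_coords_point [simp]: "plane_coords (plane_point x) = x"
  by (simp add: plane_point_def plane_coords_def vec_eq_iff forall_2)

lemma linear_plane_coords: "linear plane_coords"
  by (rule linearI) (simp_all add: plane_coords_def vec_eq_iff forall_2)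

lemma linear_plane_point: "linear plane_point"
  by (rule linearI) (simp_all add: plane_point_def complex_eq_iff)

lemma continuous_plane_point [continuous_intros]: "continuous_on S plane_point"
  by (simp add: linear_continuous_on linear_conv_bounded_linear[symmetric] linear_plane_point)

lemma measurable_plane_point [measurable]: "plane_point \<in> borel_measurable borel"
  by (intro borel_measurable_continuous_onI continuous_plane_point)

lemma image_plane_coords_eq: "plane_coords ` A = plane_point -` A"
  by (force simp: image_iff intro: exI[of _ "plane_point _"])

text \<open>Lebesgue measure is determined by its values on boxes, and the coordinates take a box to
  a box with the same side lengths.\<close>

lemma lborel_plane: "(lborel :: complex measure) = distr lborel borel plane_point"
proof (rule lborel_eqI)
  fix l u :: complex
  assume le: "\<And>b. b \<in> Basis \<Longrightarrow> l \<bullet> b \<le> u \<bullet> b"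
  have "plane_point -` box l u = box (plane_coords l) (plane_coords u)"
    by (auto simp: box_def Basis_complex_def plane_point_def plane_coords_def
        Basis_vec_def inner_axis UNIV_2)
  moreover have "\<forall>b\<in>Basis. plane_coords l \<bullet> b \<le> plane_coords u \<bullet> b"
    using le[of 1] le[of \<i>]
    by (auto simp: Basis_complex_def plane_coords_def Basis_vec_def inner_axis UNIV_2)
  moreover have "(\<Prod>b\<in>Basis. v \<bullet> b) = v $ 1 * v $ 2" for v :: "real^2"
  proof -
    have "(Basis :: (real^2) set) = {axis 1 1, axis 2 1}"
      by (auto simp: Basis_vec_def UNIV_2)
    then have "(\<Prod>b\<in>Basis. v \<bullet> b) = (\<Prod>b\<in>{axis 1 1, axis 2 1}. v \<bullet> b)"
      by (rule arg_cong)
    then show ?thesis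
      by (simp add: axis_eq_axis inner_axis)
  qed
  ultimately show "emeasure (distr lborel borel plane_point) (box l u) = (\<Prod>b\<in>Basis. (u - l) \<bullet> b)"
    using le[of 1] le[of \<i>]
    by (simp add: emeasure_distr emeasure_lborel_box Basis_complex_def plane_coords_def)
qed simp

lemma measure_image_plane_coords:
  assumes "A \<in> sets borel"
  shows "measure lebesgue (plane_coords ` A) = measure lebesgue A"
proof -
  have m: "plane_point -` A \<in> sets borel"
    using measurable_sets[OF measurable_plane_point assms] by simp
  have "emeasure lborel A = emeasure (distr lborel borel plane_point) A"
    using lborel_plane by simp
  also have "\<dots> = emeasure lborel (plane_point -` A)"
    using assms by (simp add: emeasure_distr)
  finally show ?thesis
    using m assms by (simp add: image_plane_coords_eq measure_def)
qed

lemma set_integral_plane: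
  fixes h :: "complex \<Rightarrow> real"
  assumes "set_integrable lborel A h"
  shows "set_integrable lborel (plane_coords ` A) (h \<circ> plane_point)"
    and "(LINT x:plane_coords ` A|lborel. h (plane_point x)) = (LINT z:A|lborel. h z)"
proof -
  have m: "(\<lambda>z. indicator A z *\<^sub>R h z) \<in> borel_measurable borel"
    using assms by (simp add: set_integrable_def)
  have eq: "indicator (plane_coords ` A) x *\<^sub>R h (plane_point x)
      = (indicator A (plane_point x) *\<^sub>R h (plane_point x))" for x
    by (simp add: image_plane_coords_eq indicator_def)
  have "integrable (distr lborel borel plane_point) (\<lambda>z. indicator A z *\<^sub>R h z)"
    using assms lborel_plane by (simp add: set_integrable_def)
  then show "set_integrable lborel (plane_coords ` A) (h \<circ> plane_point)"
    unfolding set_integrable_def o_def eq using m by (subst (asm) integrable_distr_eq) auto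
  have "(LINT z:A|lborel. h z) = (LINT z|distr lborel borel plane_point. indicator A z *\<^sub>R h z)"
    using lborel_plane by (simp add: set_lebesgue_integral_def)
  also have "\<dots> = (LINT x:plane_coords ` A|lborel. h (plane_point x))"
    unfolding set_lebesgue_integral_def eq using m by (subst integral_distr) auto
  finally show "(LINT x:plane_coords ` A|lborel. h (plane_point x)) = (LINT z:A|lborel. h z)"
    by simp
qed

text \<open>Multiplication by \<open>p + i q\<close> has the real matrix with rows
  \<open>(p, -q)\<close> and \<open>(q, p)\<close>.\<close>

lemma det_plane_mult: "det (matrix (plane_coords \<circ> (*) c \<circ> plane_point)) = (cmod c)\<^sup>2"
  by (simp add: det_2 matrix_def plane_coords_def plane_point_def axis_def cmod_def power2_eq_square)

text \<open>Change of variables: read in real coordinates, the derivative of \<open>F\<close> at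
  \<open>z\<close> is multiplication by \<open>deriv F z\<close>, whose determinant is the squared
  modulus.\<close>

lemma measure_holomorphic_image:
  assumes hol: "F holomorphic_on U" and U: "open U" and inj: "inj_on F U"
    and int: "set_integrable lborel U (\<lambda>z. (cmod (deriv F z))\<^sup>2)"
  shows "measure lebesgue (F ` U) = (LINT z:U|lborel. (cmod (deriv F z))\<^sup>2)"
proof -
  define g where "g = plane_coords \<circ> F \<circ> plane_point"
  define g' where "g' x = plane_coords \<circ> (*) (deriv F (plane_point x)) \<circ> plane_point" for x
  let ?V = "plane_coords ` U"
  have V: "open ?V"
    unfolding image_plane_coords_eq by (intro open_vimage U continuous_plane_point)
  have der: "(g has_derivative g' x) (at x within ?V)" if "x \<in> ?V" for x
  proof -
    have "plane_point x \<in> U"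
      using that by auto
    then have "(F has_field_derivative deriv F (plane_point x)) (at (plane_point x))"
      using hol U holomorphic_derivI by blast
    then have "(F has_derivative (*) (deriv F (plane_point x))) (at (plane_point x))"
      by (simp add: has_field_derivative_def)
    then have "(g has_derivative g' x) (at x)"
      unfolding g_def g'_def
      by (intro diff_chain_at)
        (auto intro!: linear_imp_has_derivative linear_plane_coords linear_plane_point)
    then show ?thesis
      by (rule has_derivative_at_withinI)
  qed
  have inj': "inj_on g ?V"
    using inj by (auto simp: inj_on_def g_def) (metis plane_point_coords)+
  have det: "\<bar>det (matrix (g' x))\<bar> = (cmod (deriv F (plane_point x)))\<^sup>2" for x
    by (simp add: g'_def det_plane_mult)
  note plane = set_integral_plane[OF int]
  \<comment> \<open>An injective holomorphic map is open, so the image is a Borel set.\<close>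
  have "F ` U \<in> sets borel"
    using open_mapping_thm3[OF hol U inj] by simp
  then have "measure lebesgue (F ` U) = measure lebesgue (plane_coords ` F ` U)"
    by (simp add: measure_image_plane_coords)
  also have "plane_coords ` F ` U = g ` ?V"
    by (auto simp: g_def image_iff)
  also have "measure lebesgue (g ` ?V) = integral ?V (\<lambda>x. \<bar>det (matrix (g' x))\<bar>)"
  proof (rule measure_differentiable_image_eq[OF _ der inj'])
    show "?V \<in> sets lebesgue"
      using V by simp
    show "(\<lambda>x. \<bar>det (matrix (g' x))\<bar>) integrable_on ?V"
      using set_borel_integral_eq_integral(1)[OF plane(1)] by (simp add: det o_def)
  qed
  also have "\<dots> = (LINT z:U|lborel. (cmod (deriv F z))\<^sup>2)"
    using set_borel_integral_eq_integral(2)[OF plane(1)] plane(2) by (simp add: det o_def)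
  finally show ?thesis .
qed

section \<open>Rotations, moments of discs and the area series\<close>

lemma set_integrable_ball:
  fixes h :: "complex \<Rightarrow> 'b::euclidean_space"
  assumes "continuous_on (cball 0 r) h"
  shows "set_integrable lborel (ball 0 r) h"
proof -
  have "set_integrable lborel (cball 0 r) h"
    unfolding set_integrable_def using assms by (intro borel_integrable_compact) auto
  then show ?thesis
    by (rule set_integrable_subset) (auto simp: ball_subset_cball)
qed

text \<open>A rotated box need not be a box, so its area is taken from the area formula, applied to
  multiplication by \<open>inverse c\<close>, whose Jacobian is \<open>1\<close>.\<close>

lemma lborel_rotation:
  fixes c :: complex
  assumes c: "cmod c = 1"
  shows "distr lborel borel ((*) c) = lborel"
proof (rule sym, rule lborel_eqI)
  fix l u :: complex
  assume le: "\<And>b. b \<in> Basis \<Longrightarrow> l \<bullet> b \<le> u \<bullet> b"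
  have c0: "c \<noteq> 0"
    using c by auto
  have img: "(*) c -` box l u = (*) (inverse c) ` box l u"
    using c0 by (auto simp: image_iff field_simps)
  have bdd: "bounded ((*) (inverse c) ` box l u)"
    by (intro bounded_linear_image bounded_box bounded_linear_mult_right)
  have int: "set_integrable lborel (box l u) (\<lambda>z. (cmod (inverse c))\<^sup>2)"
    by (simp add: set_integrable_def emeasure_lborel_box_eq)
  have "deriv ((*) (inverse c)) z = inverse c" for z
    by (rule DERIV_imp_deriv) (auto intro!: derivative_eq_intros)
  then have "measure lebesgue ((*) (inverse c) ` box l u) = (LINT z:box l u|lborel. (cmod (inverse c))\<^sup>2)"
    using int c0 by (subst measure_holomorphic_image)
      (auto intro!: holomorphic_intros simp: open_box inj_on_def)
  also have "\<dots> = measure lborel (box l u)"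
    using c by (simp add: set_lebesgue_integral_def norm_inverse)
  finally have "measure lborel ((*) c -` box l u) = measure lborel (box l u)"
    using measurable_sets[of "(*) c" borel borel "box l u"]
    by (simp add: img[symmetric] measure_def)
  \<comment> \<open>\<open>measure\<close> sends the value infinity to \<open>0\<close>, so
    finiteness is needed to return to \<open>emeasure\<close>.\<close>
  moreover have "emeasure lborel ((*) c -` box l u) < \<infinity>"
    unfolding img by (intro emeasure_bounded_finite bdd)
  ultimately have "emeasure lborel ((*) c -` box l u) = emeasure lborel (box l u)"
    by (metis emeasure_eq_ennreal_measure emeasure_lborel_box_finite less_irrefl infinity_ennreal_def)
  then show "emeasure (distr lborel borel ((*) c)) (box l u) = (\<Prod>b\<in>Basis. (u - l) \<bullet> b)"
    using le by (simp add: emeasure_distr emeasure_lborel_box)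
qed simp

text \<open>The rotation by \<open>cis t\<close> multiplies the integrand by
  \<open>cis ((k - l) * t)\<close>. The angle \<open>t = pi / (k - l)\<close> makes this factor
  \<open>-1\<close>, so by rotation invariance the integral is its own negative.\<close>

lemma ball_moment_orthogonal:
  assumes "k \<noteq> l"
  shows "(LINT z:ball 0 r|lborel. z ^ k * cnj z ^ l) = 0"
proof -
  define t where "t = pi / (real k - real l)"
  define h where "h z = indicator (ball 0 r) z *\<^sub>R (z ^ k * cnj z ^ l)" for z :: complex
  have [measurable]: "h \<in> borel_measurable borel"
    using set_integrable_ball[of r "\<lambda>z. z ^ k * cnj z ^ l"]
    by (simp add: set_integrable_def h_def[abs_def] continuous_intros)
  have "cis t ^ k * cnj (cis t) ^ l = cis ((real k - real l) * t)"
    by (simp add: cis_cnj Complex.DeMoivre cis_mult algebra_simps)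
  also have "\<dots> = -1"
    using assms by (simp add: t_def)
  finally have c: "cis t ^ k * cnj (cis t) ^ l = -1" .
  have "h (cis t * z) = (cis t ^ k * cnj (cis t) ^ l) * h z" for z
    by (simp add: h_def indicator_def norm_mult power_mult_distrib)
  then have neg: "h (cis t * z) = - h z" for z
    by (simp add: c)
  have "integral\<^sup>L lborel h = integral\<^sup>L (distr lborel borel ((*) (cis t))) h"
    by (simp add: lborel_rotation)
  also have "\<dots> = - integral\<^sup>L lborel h"
    by (simp add: integral_distr neg)
  finally have "integral\<^sup>L lborel h = 0"
    by simp
  then show ?thesis
    by (simp add: set_lebesgue_integral_def h_def[abs_def])
qed

text \<open>In closed form this is \<open>pi / (k + 1)\<close>. The argument relies on how the
  moments scale with the radius and on the value at \<open>k = 0\<close>.\<close>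

definition disc_moment :: "nat \<Rightarrow> real" where
  "disc_moment k = (LINT z:ball (0::complex) 1|lborel. cmod z ^ (2 * k))"

text \<open>The dilation by \<open>r\<close> contributes \<open>r\<^sup>2\<close> from the area
  element and \<open>r ^ (2 * k)\<close> from the integrand.\<close>

lemma ball_moment:
  assumes r: "0 < r"
  shows "(LINT z:ball (0::complex) r|lborel. cmod z ^ (2 * k)) = disc_moment k * r ^ (2 * k + 2)"
proof -
  define h where "h z = indicator (ball 0 r) z *\<^sub>R (cmod z ^ (2 * k))" for z :: complex
  have [measurable]: "h \<in> borel_measurable borel"
    using set_integrable_ball[of r "\<lambda>z. cmod z ^ (2 * k)"]
    by (simp add: set_integrable_def h_def[abs_def] continuous_intros)
  have sc: "h (r *\<^sub>R z) = r ^ (2 * k) * (indicator (ball 0 1) z *\<^sub>R cmod z ^ (2 * k))" for z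
    using r by (simp add: h_def indicator_def power_mult_distrib)
  have "integral\<^sup>L lborel h
      = integral\<^sup>L (density (distr lborel borel (\<lambda>x::complex. 0 + r *\<^sub>R x)) (\<lambda>_. ennreal (r\<^sup>2))) h"
    using r by (subst lborel_affine[of r "0::complex"]) (auto simp: ennreal_power)
  also have "\<dots> = r\<^sup>2 * (LINT z|lborel. h (r *\<^sub>R z))"
    by (subst integral_density) (auto simp: integral_distr)
  also have "\<dots> = disc_moment k * r ^ (2 * k + 2)"
    unfolding sc integral_mult_right_zero disc_moment_def set_lebesgue_integral_def
    by (simp add: power_add power2_eq_square)
  finally show ?thesis
    by (simp add: set_lebesgue_integral_def h_def[abs_def])
qed

lemma disc_moment_0: "disc_moment 0 = pi"
proof -
  have "disc_moment 0 = measure lborel (ball (0::complex) 1)"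
    by (simp add: disc_moment_def set_lebesgue_integral_def)
  then show ?thesis
    using content_ball[of 1 "0::complex"] by (simp add: unit_ball_vol_2)
qed

text \<open>The squared modulus of the sum is a finite double sum of mixed moments, of which
  orthogonality leaves only the diagonal.\<close>

lemma area_polynomial:
  fixes b :: "nat \<Rightarrow> complex"
  assumes r: "0 < r"
  shows "(LINT z:ball 0 r|lborel. (cmod (\<Sum>k<N. b k * z ^ k))\<^sup>2)
     = (\<Sum>k<N. (cmod (b k))\<^sup>2 * (disc_moment k * r ^ (2 * k + 2)))"
proof -
  have int: "integrable lborel (\<lambda>z. indicator (ball 0 r) z *\<^sub>R (z ^ k * cnj z ^ l))" for k l
    using set_integrable_ball[of r "\<lambda>z. z ^ k * cnj z ^ l"]
    by (simp add: set_integrable_def continuous_intros)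
  have diag: "(LINT z:ball 0 r|lborel. z ^ k * cnj z ^ k) = of_real (disc_moment k * r ^ (2 * k + 2))" for k
  proof -
    have "z ^ k * cnj z ^ k = of_real (cmod z ^ (2 * k))" for z
      by (simp add: power_mult power_mult_distrib[symmetric] flip: complex_norm_square)
    then show ?thesis
      unfolding ball_moment[OF r, of k, symmetric] by (simp only: set_integral_complex_of_real)
  qed
  have expand: "of_real ((cmod (\<Sum>k<N. b k * z ^ k))\<^sup>2)
      = (\<Sum>k<N. \<Sum>l<N. b k * cnj (b l) * (z ^ k * cnj z ^ l))" for z
    unfolding complex_norm_square by (simp add: sum_product algebra_simps)
  have "of_real (LINT z:ball 0 r|lborel. (cmod (\<Sum>k<N. b k * z ^ k))\<^sup>2)
      = (LINT z:ball 0 r|lborel. (\<Sum>k<N. \<Sum>l<N. b k * cnj (b l) * (z ^ k * cnj z ^ l)))"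
    by (simp only: expand flip: set_integral_complex_of_real)
  also have "\<dots> = (LINT z|lborel. (\<Sum>k<N. \<Sum>l<N. b k * cnj (b l) * (indicator (ball 0 r) z *\<^sub>R (z ^ k * cnj z ^ l))))"
    unfolding set_lebesgue_integral_def by (simp add: scaleR_sum_right)
  also have "\<dots> = (\<Sum>k<N. \<Sum>l<N. b k * cnj (b l) * (LINT z:ball 0 r|lborel. z ^ k * cnj z ^ l))"
    unfolding set_lebesgue_integral_def
    by (subst Bochner_Integration.integral_sum | intro Bochner_Integration.integrable_sum integrable_mult_right int
        sum.cong refl | simp add: int del: mult_scaleR_right)+
  also have "\<dots> = (\<Sum>k<N. \<Sum>l<N. if l = k then b k * cnj (b l) * (LINT z:ball 0 r|lborel. z ^ k * cnj z ^ l) else 0)"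
    by (intro sum.cong refl) (simp add: ball_moment_orthogonal)
  also have "\<dots> = of_real (\<Sum>k<N. (cmod (b k))\<^sup>2 * (disc_moment k * r ^ (2 * k + 2)))"
    unfolding of_real_sum by (intro sum.cong refl) (simp add: diag flip: complex_norm_square)
  finally show ?thesis
    using of_real_eq_iff by blast
qed

text \<open>The partial sums of the series are the integrals belonging to the Taylor polynomials of
  \<open>deriv F\<close>. Dominated convergence passes to the limit, which the area formula
  identifies as the area of the image.\<close>

lemma area_holomorphic_image_sums:
  assumes hol: "F holomorphic_on ball 0 R" and inj: "inj_on F (ball 0 R)" and r: "0 < r" "r < R"
  defines "b \<equiv> (\<lambda>k. (deriv ^^ k) (deriv F) 0 / fact k)"
  shows "(\<lambda>k. (cmod (b k))\<^sup>2 * (disc_moment k * r ^ (2 * k + 2))) sums measure lebesgue (F ` ball 0 r)"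
proof -
  have hol': "deriv F holomorphic_on ball 0 R"
    using hol by (intro holomorphic_deriv) auto
  have sums: "(\<lambda>k. b k * z ^ k) sums deriv F z" if "cmod z < R" for z
    using holomorphic_power_series[OF hol', of z] that by (simp add: b_def)
  \<comment> \<open>A radius strictly between \<open>r\<close> and \<open>R\<close>: convergence at
    \<open>R'\<close> gives absolute convergence at \<open>r\<close>.\<close>
  define R' where "R' = (r + R) / 2"
  have R': "r < R'" "R' < R"
    using r by (auto simp: R'_def)
  have "summable (\<lambda>k. b k * of_real R' ^ k)"
    using sums[of "of_real R'"] r R' by (auto simp: sums_iff)
  then have summ: "summable (\<lambda>k. cmod (b k * of_real r ^ k))"
    by (rule powser_insidea) (use r R' in auto)
  \<comment> \<open>\<open>C\<close> bounds all Taylor polynomials on the disc at once, so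
    \<open>C\<^sup>2\<close> can serve as the dominating function.\<close>
  define C where "C = (\<Sum>k. cmod (b k * of_real r ^ k))"
  have bound: "cmod (\<Sum>k<N. b k * z ^ k) \<le> C" if "cmod z < r" for z N
  proof -
    have "cmod (\<Sum>k<N. b k * z ^ k) \<le> (\<Sum>k<N. cmod (b k * of_real r ^ k))"
      using that r by (intro sum_norm_le) (auto simp: norm_mult norm_power intro!: mult_left_mono power_mono)
    also have "\<dots> \<le> C"
      unfolding C_def by (intro sum_le_suminf summ) auto
    finally show ?thesis .
  qed
  have sub: "ball 0 r \<subseteq> ball (0::complex) R" "cball 0 r \<subseteq> ball (0::complex) R"
    using r by auto
  have contd: "continuous_on (cball 0 r) (deriv F)"
    using hol' sub holomorphic_on_imp_continuous_on holomorphic_on_subset by blast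
  have intd: "set_integrable lborel (ball 0 r) (\<lambda>z. (cmod (deriv F z))\<^sup>2)"
    by (intro set_integrable_ball continuous_intros contd)
  have "(\<lambda>N. LINT z:ball 0 r|lborel. (cmod (\<Sum>k<N. b k * z ^ k))\<^sup>2)
      \<longlonglongrightarrow> (LINT z:ball 0 r|lborel. (cmod (deriv F z))\<^sup>2)"
    unfolding set_lebesgue_integral_def
  proof (rule integral_dominated_convergence[where w = "\<lambda>z. indicator (ball 0 r) z *\<^sub>R C\<^sup>2"])
    show "(\<lambda>z. indicator (ball 0 r) z *\<^sub>R (cmod (deriv F z))\<^sup>2) \<in> borel_measurable lborel"
      using intd by (simp add: set_integrable_def)
    show "integrable lborel (\<lambda>z::complex. indicator (ball 0 r) z *\<^sub>R C\<^sup>2)"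
      using set_integrable_ball[of r "\<lambda>z. C\<^sup>2"] by (simp add: set_integrable_def)
    show "AE z in lborel. (\<lambda>N. indicator (ball 0 r) z *\<^sub>R (cmod (\<Sum>k<N. b k * z ^ k))\<^sup>2)
        \<longlonglongrightarrow> indicator (ball 0 r) z *\<^sub>R (cmod (deriv F z))\<^sup>2"
    proof (intro AE_I2)
      fix z :: complex
      show "(\<lambda>N. indicator (ball 0 r) z *\<^sub>R (cmod (\<Sum>k<N. b k * z ^ k))\<^sup>2)
        \<longlonglongrightarrow> indicator (ball 0 r) z *\<^sub>R (cmod (deriv F z))\<^sup>2"
        using sums[of z] r unfolding sums_def
        by (cases "cmod z < r") (auto intro!: tendsto_intros)
    qed
    show "AE z in lborel. norm (indicator (ball 0 r) z *\<^sub>R (cmod (\<Sum>k<N. b k * z ^ k))\<^sup>2)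
        \<le> indicator (ball 0 r) z *\<^sub>R C\<^sup>2" for N
      by (intro AE_I2) (auto simp: indicator_def intro!: power_mono bound)
    show "(\<lambda>z. indicator (ball 0 r) z *\<^sub>R (cmod (\<Sum>k<N. b k * z ^ k))\<^sup>2) \<in> borel_measurable lborel" for N
      using set_integrable_ball[of r "\<lambda>z. (cmod (\<Sum>k<N. b k * z ^ k))\<^sup>2"]
      by (simp add: set_integrable_def continuous_intros)
  qed
  then have "(\<lambda>k. (cmod (b k))\<^sup>2 * (disc_moment k * r ^ (2 * k + 2)))
      sums (LINT z:ball 0 r|lborel. (cmod (deriv F z))\<^sup>2)"
    unfolding sums_def area_polynomial[OF r(1)] .
  moreover have "measure lebesgue (F ` ball 0 r) = (LINT z:ball 0 r|lborel. (cmod (deriv F z))\<^sup>2)"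
    using hol inj sub by (intro measure_holomorphic_image intd) (auto intro: holomorphic_on_subset inj_on_subset)
  ultimately show ?thesis
    by simp
qed

subsection \<open>Mean radius and generalized derivative\<close>

text \<open>The area divided by \<open>pi * r\<^sup>2\<close> is a power series in
  \<open>r\<^sup>2\<close> with real coefficients. Putting a complex variable \<open>w\<close> in
  place of \<open>r\<^sup>2\<close> turns this function of the radius into a holomorphic germ
  \<open>u\<close>.\<close>

lemma mean_radius_power_series:
  assumes S: "open S" "0 \<in> S" and hol: "f holomorphic_on S" and dnz: "deriv f 0 \<noteq> 0"
  obtains R u where "0 < R" "u holomorphic_on ball 0 R" "u 0 = of_real ((cmod (deriv f 0))\<^sup>2)"
    "\<And>w. w \<in> ball 0 R \<Longrightarrow> w \<in> \<real> \<Longrightarrow> u w \<in> \<real>"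
    "\<And>r. 0 < r \<Longrightarrow> r\<^sup>2 < R \<Longrightarrow> mean_radius f r = r * sqrt (Re (u (of_real (r\<^sup>2))))"
proof -
  obtain R0 where R0: "0 < R0" "ball 0 R0 \<subseteq> S" "inj_on f (ball 0 R0)"
    using has_complex_derivative_locally_injective[OF hol S(2,1) dnz] .
  have hol0: "f holomorphic_on ball 0 R0"
    using hol R0 holomorphic_on_subset by blast
  define b where "b k = (deriv ^^ k) (deriv f) 0 / fact k" for k
  define c where "c k = (cmod (b k))\<^sup>2 * disc_moment k / pi" for k
  define u where "u w = (\<Sum>k. of_real (c k) * w ^ k)" for w :: complex
  have area: "(\<lambda>k. c k * (r\<^sup>2) ^ k) sums (measure lebesgue (f ` ball 0 r) / (pi * r\<^sup>2))"
    if "0 < r" "r < R0" for r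
  proof -
    have "(cmod (b k))\<^sup>2 * (disc_moment k * r ^ (2 * k + 2)) / (pi * r\<^sup>2) = c k * (r\<^sup>2) ^ k" for k
    proof -
      have "r ^ (2 * k + 2) = r\<^sup>2 * (r\<^sup>2) ^ k"
        unfolding power_add power_mult by (rule mult.commute)
      then show ?thesis
        using that by (simp add: c_def)
    qed
    then show ?thesis
      using sums_divide[OF area_holomorphic_image_sums[OF hol0 R0(3) that], of "pi * r\<^sup>2"]
      by (simp only: b_def)
  qed
  have csums: "(\<lambda>k. of_real (c k) * (of_real (r\<^sup>2)) ^ k)
      sums (of_real (measure lebesgue (f ` ball 0 r) / (pi * r\<^sup>2)) :: complex)"
    if "0 < r" "r < R0" for r
    using sums_of_real[OF area[OF that], where 'a = complex] by simp
  have usums: "(\<lambda>k. of_real (c k) * w ^ k) sums u w" if "w \<in> ball 0 (R0\<^sup>2)" for w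
  proof -
    \<comment> \<open>The midpoint satisfies \<open>cmod w < r\<^sup>2\<close> and
      \<open>r < R0\<close>, so convergence at the point \<open>r\<^sup>2\<close>, known from the
      area, carries over to \<open>w\<close>.\<close>
    define r where "r = (sqrt (cmod w) + R0) / 2"
    have "sqrt (cmod w) < R0"
      using that R0 by (simp add: real_less_lsqrt)
    then have r: "sqrt (cmod w) < r" "r < R0"
      by (auto simp: r_def)
    moreover have "0 \<le> sqrt (cmod w)"
      by simp
    ultimately have r0: "0 < r"
      by linarith
    have "(sqrt (cmod w))\<^sup>2 < r\<^sup>2"
      using r by (intro power_strict_mono) auto
    then have "cmod w < r\<^sup>2"
      by simp
    then have "summable (\<lambda>k. of_real (c k) * w ^ k)"
      using r0 by (intro powser_inside[OF sums_summable[OF csums[OF r0 r(2)]]]) (simp add: norm_power)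
    then show ?thesis
      by (simp add: u_def summable_sums)
  qed
  show ?thesis
  proof
    show "0 < R0\<^sup>2"
      using R0 by simp
    show "u holomorphic_on ball 0 (R0\<^sup>2)"
      using usums by (intro power_series_holomorphic[of 0 "R0\<^sup>2" "\<lambda>k. of_real (c k)"]) simp
    \<comment> \<open>Only the constant term survives at \<open>0\<close>; there
      \<open>disc_moment 0 = pi\<close> cancels the division by \<open>pi\<close> in
      \<open>c 0\<close>.\<close>
    have "(\<lambda>k. of_real (c k) * 0 ^ k) sums (of_real (c 0) :: complex)"
      using powser_sums_zero[of "\<lambda>k. of_real (c k) :: complex"] by simp
    moreover have "(\<lambda>k. of_real (c k) * 0 ^ k) sums u 0"
      using usums[of 0] R0 by simp
    ultimately have "u 0 = of_real (c 0)"
      using sums_unique2 by blast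
    then show "u 0 = of_real ((cmod (deriv f 0))\<^sup>2)"
      unfolding c_def b_def disc_moment_0 by simp
    show "u w \<in> \<real>" if w: "w \<in> ball 0 (R0\<^sup>2)" "w \<in> \<real>" for w
    proof -
      obtain x where x: "w = of_real x"
        using w(2) by (rule Reals_cases)
      \<comment> \<open>The partial sums at a real point are real, and the real line is
        closed.\<close>
      have "(\<Sum>k<N. of_real (c k) * w ^ k) \<in> \<real>" for N
        unfolding x by (intro sum_in_Reals Reals_mult Reals_power Reals_of_real)
      moreover have "(\<lambda>N. \<Sum>k<N. of_real (c k) * w ^ k) \<longlonglongrightarrow> u w"
        using usums[OF w(1)] by (simp add: sums_def)
      ultimately show ?thesis
        by (rule closed_sequentially[OF closed_complex_Reals])
    qed
    show "mean_radius f r = r * sqrt (Re (u (of_real (r\<^sup>2))))" if "0 < r" "r\<^sup>2 < R0\<^sup>2" for r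
    proof -
      have r: "r < R0"
        using that R0 by (simp add: power_less_imp_less_base)
      have "u (of_real (r\<^sup>2)) = of_real (measure lebesgue (f ` ball 0 r) / (pi * r\<^sup>2))"
        unfolding u_def by (rule sums_unique[OF csums[OF that(1) r], symmetric])
      then have "Re (u (of_real (r\<^sup>2))) = measure lebesgue (f ` ball 0 r) / pi / r\<^sup>2"
        by simp
      then show ?thesis
        using that by (simp add: mean_radius_def real_sqrt_divide real_sqrt_mult)
    qed
  qed
qed

text \<open>With \<open>h\<close> the difference quotient,
  \<open>f (r * w) / mean_radius f r\<close> is the product of \<open>w\<close>,
  \<open>h (r * w)\<close> and \<open>r / mean_radius f r\<close>. On bounded sets the last two tend
  uniformly to \<open>a\<close> and \<open>1 / cmod a\<close> along every null sequence of positive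
  radii, so no other limit can occur.\<close>

lemma generalized_derivative_iff:
  assumes der: "(f has_field_derivative a) (at 0)" and f0: "f 0 = 0" and a: "a \<noteq> 0"
    and rho: "((\<lambda>r. mean_radius f r / r) \<longlongrightarrow> cmod a) (at_right 0)"
  shows "generalized_derivative f g \<longleftrightarrow> g = (\<lambda>z. a / of_real (cmod a) * z)"
proof -
  \<comment> \<open>The value \<open>a\<close> at \<open>0\<close> makes \<open>h\<close> continuous
    there, and \<open>f 0 = 0\<close> gives \<open>f \<zeta> = \<zeta> * h \<zeta>\<close> also at
    \<open>0\<close>.\<close>
  define h where "h \<zeta> = (if \<zeta> = 0 then a else f \<zeta> / \<zeta>)" for \<zeta>
  let ?g = "\<lambda>z. a / of_real (cmod a) * z"
  have "((\<lambda>\<zeta>. f \<zeta> / \<zeta>) \<longlongrightarrow> a) (at 0)"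
    using der f0 by (simp add: has_field_derivative_iff)
  then have "(h \<longlongrightarrow> h 0) (at 0)"
    by (rule filterlim_cong[THEN iffD1, rotated -1])
      (auto simp: h_def eventually_at intro: zero_less_one)
  then have "isCont h 0"
    by (simp add: isCont_def)
  then have cont: "\<exists>\<delta>>0. \<forall>\<zeta>. cmod \<zeta> < \<delta> \<longrightarrow> cmod (h \<zeta> - a) < \<epsilon>" if "0 < \<epsilon>" for \<epsilon>
    using that by (fastforce simp: continuous_at_eps_delta h_def dist_norm)
  have lim: "uniform_limit (ball z 1) (\<lambda>k w. f (of_real (r k) * w) / of_real (mean_radius f (r k))) ?g sequentially"
    if r: "\<And>k. 0 < r k" "r \<longlonglongrightarrow> 0" for z :: complex and r :: "nat \<Rightarrow> real"
  proof -
    have hlim: "uniform_limit (ball z 1) (\<lambda>k w. h (of_real (r k) * w)) (\<lambda>w. a) sequentially"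
      unfolding uniform_limit_iff
    proof (intro allI impI)
      fix \<epsilon> :: real assume "0 < \<epsilon>"
      then obtain \<delta> where \<delta>: "0 < \<delta>" "\<And>\<zeta>. cmod \<zeta> < \<delta> \<Longrightarrow> cmod (h \<zeta> - a) < \<epsilon>"
        using cont by blast
      have "(\<lambda>k. r k * (cmod z + 1)) \<longlonglongrightarrow> 0"
        using tendsto_mult[OF r(2) tendsto_const[of "cmod z + 1"]] by simp
      then have "\<forall>\<^sub>F k in sequentially. r k * (cmod z + 1) < \<delta>"
        using \<delta>(1) by (rule order_tendstoD)
      then show "\<forall>\<^sub>F k in sequentially. \<forall>w\<in>ball z 1. dist (h (of_real (r k) * w)) a < \<epsilon>"
      proof eventually_elim
        case (elim k)
        show ?case
        proof
          fix w assume "w \<in> ball z 1"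
          then have "cmod w \<le> cmod z + 1"
            using norm_triangle_ineq2[of w z] by (simp add: dist_norm norm_minus_commute)
          then have "r k * cmod w \<le> r k * (cmod z + 1)"
            using r(1)[of k] by (intro mult_left_mono) auto
          also note elim
          finally have "cmod (of_real (r k) * w) < \<delta>"
            using r(1)[of k] by (simp add: norm_mult)
          then show "dist (h (of_real (r k) * w)) a < \<epsilon>"
            using \<delta>(2) by (simp add: dist_norm)
        qed
      qed
    qed
    have "filterlim r (at_right 0) sequentially"
      using r by (auto intro!: tendsto_imp_filterlim_at_right always_eventually)
    then have "(\<lambda>k. mean_radius f (r k) / r k) \<longlonglongrightarrow> cmod a"
      using filterlim_compose[OF rho] by blast
    then have "(\<lambda>k. of_real (inverse (mean_radius f (r k) / r k))) \<longlonglongrightarrow> (of_real (inverse (cmod a)) :: complex)"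
      using a by (intro tendsto_of_real tendsto_inverse) auto
    then have rlim: "uniform_limit (ball z 1) (\<lambda>k w. of_real (inverse (mean_radius f (r k) / r k)))
        (\<lambda>w. of_real (inverse (cmod a)) :: complex) sequentially"
      by (auto simp: uniform_limit_iff dest: tendstoD)
    \<comment> \<open>Uniform limits may be multiplied when the limits are bounded, which holds on a
      disc of radius \<open>1\<close>.\<close>
    have bdd: "bounded ((\<lambda>w. w * a) ` ball z 1)"
      by (intro bounded_linear_image bounded_ball bounded_linear_mult_left)
    have "uniform_limit (ball z 1) (\<lambda>k w. w * h (of_real (r k) * w)) (\<lambda>w. w * a) sequentially"
      by (intro uniform_lim_mult hlim) (auto simp: image_constant_conv uniform_limit_iff)
    then have "uniform_limit (ball z 1)
        (\<lambda>k w. (w * h (of_real (r k) * w)) * of_real (inverse (mean_radius f (r k) / r k)))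
        (\<lambda>w. (w * a) * of_real (inverse (cmod a))) sequentially"
      by (rule uniform_lim_mult[OF _ rlim bdd]) (auto simp: image_constant_conv)
    moreover have "(w * h (of_real (r k) * w)) * of_real (inverse (mean_radius f (r k) / r k))
        = f (of_real (r k) * w) / of_real (mean_radius f (r k))" for k w
      using r(1)[of k] by (simp add: h_def f0 field_simps)
    moreover have "(w * a) * of_real (inverse (cmod a)) = ?g w" for w
      by (simp add: field_simps)
    ultimately show ?thesis
      by (simp only:)
  qed
  show ?thesis
  proof
    assume "generalized_derivative f g"
    then obtain r :: "nat \<Rightarrow> real" where r: "\<And>k. 0 < r k" "r \<longlonglongrightarrow> 0"
      and unif: "\<And>z. \<exists>e>0. uniform_limit (ball z e)
           (\<lambda>k w. f (of_real (r k) * w) / of_real (mean_radius f (r k))) g sequentially"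
      unfolding generalized_derivative_def by blast
    have "g z = ?g z" for z
    proof -
      obtain e where "0 < e" "uniform_limit (ball z e)
           (\<lambda>k w. f (of_real (r k) * w) / of_real (mean_radius f (r k))) g sequentially"
        using unif by blast
      then have "(\<lambda>k. f (of_real (r k) * z) / of_real (mean_radius f (r k))) \<longlonglongrightarrow> g z"
        by (auto intro: tendsto_uniform_limitI)
      moreover have "(\<lambda>k. f (of_real (r k) * z) / of_real (mean_radius f (r k))) \<longlonglongrightarrow> ?g z"
        using tendsto_uniform_limitI[OF lim[OF r, of z], of z] by simp
      ultimately show ?thesis
        by (rule LIMSEQ_unique)
    qed
    then show "g = ?g"
      by blast
  next
    assume g: "g = ?g"
    \<comment> \<open>Existence needs one admissible sequence of radii; the limit above is available
      for any.\<close>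
    define r where "r k = inverse (real (Suc k))" for k
    have "decseq r"
      unfolding r_def by (intro decseq_SucI le_imp_inverse_le) auto
    moreover have pos: "0 < r k" for k
      by (simp add: r_def)
    moreover have r0: "r \<longlonglongrightarrow> 0"
      unfolding r_def by (rule LIMSEQ_inverse_real_of_nat)
    moreover have "\<exists>e>0. uniform_limit (ball z e)
        (\<lambda>k w. f (of_real (r k) * w) / of_real (mean_radius f (r k))) g sequentially" for z
      unfolding g using lim[OF pos r0, of z] zero_less_one by blast
    ultimately show "generalized_derivative f g"
      unfolding generalized_derivative_def by blast
  qed
qed

subsection \<open>Linearization by an infinite product\<close>

text \<open>The limit is \<open>G w = (\<Prod>n. v ((T ^^ n) w))\<close>; it converges since \<open>(T ^^ n) w\<close> decays geometrically.\<close>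

lemma attracting_infinite_product:
  fixes T v :: "complex \<Rightarrow> complex"
  assumes d: "0 < d" and holT: "T holomorphic_on ball 0 d" and holv: "v holomorphic_on ball 0 d"
    and \<mu>: "0 \<le> \<mu>" "\<mu> < 1" and contr: "\<And>w. w \<in> ball 0 d \<Longrightarrow> cmod (T w) \<le> \<mu> * cmod w"
    and v0: "v 0 = 1"
    and realT: "\<And>w. w \<in> ball 0 d \<Longrightarrow> w \<in> \<real> \<Longrightarrow> T w \<in> \<real>"
    and realv: "\<And>w. w \<in> ball 0 d \<Longrightarrow> w \<in> \<real> \<Longrightarrow> v w \<in> \<real>"
  obtains e G where "0 < e" "e \<le> d" "G holomorphic_on ball 0 e" "G 0 = 1"
    "\<And>w. w \<in> ball 0 e \<Longrightarrow> G w = v w * G (T w)"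
    "\<And>w. w \<in> ball 0 e \<Longrightarrow> w \<in> \<real> \<Longrightarrow> G w \<in> \<real>"
proof -
  \<comment> \<open>Halving the radius leaves a compact disc inside the domain, on which
    \<open>deriv v\<close> is bounded.\<close>
  define e where "e = d / 2"
  have e: "0 < e" "e < d"
    using d by (auto simp: e_def)
  let ?A = "cball (0::complex) e"
  have sub: "?A \<subseteq> ball 0 d"
    using e by auto
  have iter: "cmod ((T ^^ n) w) \<le> \<mu> ^ n * cmod w" if "w \<in> ball 0 d" for n w
  proof (induction n)
    case (Suc n)
    have "\<mu> ^ n * cmod w \<le> 1 * cmod w"
      using \<mu> by (intro mult_right_mono power_le_one) auto
    then have "(T ^^ n) w \<in> ball 0 d"
      using Suc that by simp
    then have "cmod (T ((T ^^ n) w)) \<le> \<mu> * cmod ((T ^^ n) w)"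
      by (rule contr)
    also have "\<dots> \<le> \<mu> * (\<mu> ^ n * cmod w)"
      using Suc \<mu> by (intro mult_left_mono)
    finally show ?case
      by simp
  qed simp
  have iter_le: "cmod ((T ^^ n) w) \<le> cmod w" if "w \<in> ball 0 d" for n w
  proof -
    have "\<mu> ^ n * cmod w \<le> 1 * cmod w"
      using \<mu> by (intro mult_right_mono power_le_one) auto
    then show ?thesis
      using iter[OF that, of n] by simp
  qed
  have iter_ball: "(T ^^ n) w \<in> ball 0 d" if "w \<in> ball 0 d" for n w
    using iter_le[OF that, of n] that by simp
  have iter_image: "(T ^^ n) ` ball 0 d \<subseteq> ball 0 d" for n
    using iter_ball by blast
  have hol_iter: "(T ^^ n) holomorphic_on ball 0 d" for n
  proof (induction n)
    case (Suc n)
    show ?case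
      using holomorphic_on_compose_gen[OF Suc holT iter_image] by (simp add: o_def)
  qed (auto simp: id_def)
  define f where "f n w = v ((T ^^ n) w)" for n w
  have holf: "f n holomorphic_on ball 0 d" for n
    using holomorphic_on_compose_gen[OF hol_iter holv iter_image] by (simp add: f_def[abs_def] o_def)
  have "continuous_on ?A (deriv v)"
    using holomorphic_deriv[OF holv] sub
    by (meson holomorphic_on_imp_continuous_on holomorphic_on_subset open_ball)
  then have "bounded (deriv v ` ?A)"
    by (intro compact_imp_bounded compact_continuous_image) auto
  then obtain C where C: "\<And>w. w \<in> ?A \<Longrightarrow> cmod (deriv v w) \<le> C"
    unfolding bounded_iff by blast
  \<comment> \<open>Mean value inequality on the convex disc, with \<open>v 0 = 1\<close>: the
    factors tend to \<open>1\<close> as fast as the iterates tend to \<open>0\<close>.\<close>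
  have lip: "cmod (v w - 1) \<le> C * cmod w" if "w \<in> ?A" for w
  proof -
    have "(v has_field_derivative deriv v z) (at z within ?A)" if "z \<in> ?A" for z
      using holv that sub by (meson holomorphic_derivI open_ball subsetD)
    then have "cmod (v w - v 0) \<le> C * cmod (w - 0)"
      using C that e by (intro field_differentiable_bound[of ?A]) auto
    then show ?thesis
      by (simp add: v0)
  qed
  have C0: "0 \<le> C"
    using C[of 0] e norm_ge_zero[of "deriv v 0"] by (simp del: norm_ge_zero)
  have bound: "norm (norm (f n w - 1)) \<le> (C * e) * \<mu> ^ n" if "w \<in> ?A" for n w
  proof -
    have wd: "w \<in> ball 0 d"
      using that sub by blast
    have "(T ^^ n) w \<in> ?A"
      using iter_le[OF wd, of n] that by simp
    then have "cmod (f n w - 1) \<le> C * cmod ((T ^^ n) w)"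
      unfolding f_def by (rule lip)
    also have "\<dots> \<le> C * (\<mu> ^ n * e)"
      using iter[OF wd, of n] that \<mu> C0
      by (intro mult_left_mono order_trans[OF iter[OF wd]]) auto
    finally show ?thesis
      by (simp add: mult_ac)
  qed
  have "summable (\<lambda>n. (C * e) * \<mu> ^ n)"
    using \<mu> by (intro summable_mult summable_geometric) auto
  then have "uniformly_convergent_on ?A (\<lambda>N w. \<Sum>n<N. norm (f n w - 1))"
    by (intro Weierstrass_m_test'[where M = "\<lambda>n. (C * e) * \<mu> ^ n"] bound)
  moreover have contf: "continuous_on ?A (f n)" for n
    using holf sub by (meson holomorphic_on_imp_continuous_on holomorphic_on_subset)
  ultimately have "uniformly_convergent_on ?A (\<lambda>N w. \<Prod>n<N. f n w)"
    by (intro uniformly_convergent_on_prod') auto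
  then obtain G where G: "uniform_limit ?A (\<lambda>N w. \<Prod>n<N. f n w) G sequentially"
    unfolding uniformly_convergent_on_def by blast
  have lim: "(\<lambda>N. \<Prod>n<N. f n w) \<longlonglongrightarrow> G w" if "w \<in> ?A" for w
    using tendsto_uniform_limitI[OF G that] .
  show ?thesis
  proof
    show "0 < e" "e \<le> d"
      using e by auto
    show "G holomorphic_on ball 0 e"
    proof (rule holomorphic_uniform_limit[OF _ G])
      have "(\<lambda>w. \<Prod>n<N. f n w) holomorphic_on ball 0 e" for N
        using e by (intro holomorphic_intros holomorphic_on_subset[OF holf]) auto
      then show "\<forall>\<^sub>F N in sequentially. continuous_on ?A (\<lambda>w. \<Prod>n<N. f n w)
          \<and> (\<lambda>w. \<Prod>n<N. f n w) holomorphic_on ball 0 e"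
        by (auto intro!: always_eventually continuous_intros contf)
    qed auto
    \<comment> \<open>The contraction bound forces all iterates to fix \<open>0\<close>, so every
      factor there is \<open>v 0\<close>.\<close>
    have "f n 0 = 1" for n
      using iter_le[of 0 n] d by (simp add: f_def v0)
    then have "(\<lambda>N. 1) \<longlonglongrightarrow> G 0"
      using lim[of 0] e by simp
    then show "G 0 = 1"
      using LIMSEQ_unique tendsto_const by blast
    show "G w = v w * G (T w)" if "w \<in> ball 0 e" for w
    proof -
      have w: "w \<in> ball 0 d" "w \<in> ?A"
        using that e by auto
      have Tw: "T w \<in> ?A"
        using iter_le[OF w(1), of 1] that by simp
      \<comment> \<open>Splitting off the first factor leaves the product that belongs to
        \<open>T w\<close>; in the limit this is the functional equation.\<close>
      have "(\<Prod>n<Suc N. f n w) = v w * (\<Prod>n<N. f n (T w))" for N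
        unfolding prod.lessThan_Suc_shift by (simp add: f_def funpow_swap1)
      then have "(\<lambda>N. \<Prod>n<Suc N. f n w) \<longlonglongrightarrow> v w * G (T w)"
        by (auto intro!: tendsto_intros lim Tw)
      then show ?thesis
        using LIMSEQ_unique[OF LIMSEQ_Suc[OF lim[OF w(2)]]] by blast
    qed
    show "G w \<in> \<real>" if "w \<in> ball 0 e" "w \<in> \<real>" for w
    proof (rule closed_sequentially[OF closed_complex_Reals])
      have w: "w \<in> ball 0 d" "w \<in> ?A"
        using that e by auto
      show "(\<lambda>N. \<Prod>n<N. f n w) \<longlonglongrightarrow> G w"
        by (rule lim[OF w(2)])
      have "(T ^^ n) w \<in> \<real>" for n
        by (induction n) (auto intro: that realT iter_ball[OF w(1)])
      then have "f n w \<in> \<real>" for n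
        unfolding f_def by (intro realv iter_ball w(1))
      then show "(\<Prod>n<N. f n w) \<in> \<real>" for N
        by (intro prod_in_Reals)
    qed
  qed
qed

subsection \<open>Smooth radial maps\<close>

lemma Ck_on_SucD:
  assumes "Ck_on (Suc k) S f"
  shows "\<And>x. x \<in> S \<Longrightarrow> (f has_derivative frechet_derivative f (at x)) (at x)"
    and "\<And>v. Ck_on k S (\<lambda>x. frechet_derivative f (at x) v)"
  using assms by (auto simp: frechet_derivative_works)

text \<open>Differentiability at a point of an open set sees only nearby values, and
  \<open>frechet_derivative\<close> is a choice from the \<open>has_derivative\<close> predicate, so
  equivalent predicates yield the same derivative.\<close>

lemma Ck_on_cong:
  assumes "open S" "\<And>x. x \<in> S \<Longrightarrow> f x = g x"
  shows "Ck_on k S f \<longleftrightarrow> Ck_on k S g"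
  using assms(2)
proof (induction k arbitrary: f g)
  case (Suc k)
  have eq: "(f has_derivative D) (at x) \<longleftrightarrow> (g has_derivative D) (at x)" if "x \<in> S" for x D
    using Suc.prems that assms(1)
    by (metis has_derivative_transform_within_open)
  then have "frechet_derivative f (at x) = frechet_derivative g (at x)" if "x \<in> S" for x
    using that by (simp add: frechet_derivative_def)
  then have "Ck_on k S (\<lambda>x. frechet_derivative f (at x) v)
      \<longleftrightarrow> Ck_on k S (\<lambda>x. frechet_derivative g (at x) v)" for v
    by (intro Suc.IH) auto
  with eq show ?case
    by (auto simp: differentiable_def)
qed (simp cong: continuous_on_cong)

text \<open>Since \<open>frechet_derivative\<close> is a choice term, this rule lets smoothness be
  checked on an explicit formula for the derivative.\<close>

lemma Ck_on_SucI:
  assumes S: "open S" and der: "\<And>x. x \<in> S \<Longrightarrow> (f has_derivative D x) (at x)"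
    and "\<And>v. Ck_on k S (\<lambda>x. D x v)"
  shows "Ck_on (Suc k) S f"
proof -
  have "frechet_derivative f (at x) = D x" if "x \<in> S" for x
    using frechet_derivative_at[OF der[OF that]] by simp
  then have "Ck_on k S (\<lambda>x. frechet_derivative f (at x) v)" for v
    using assms(3) Ck_on_cong[OF S, of "\<lambda>x. frechet_derivative f (at x) v" "\<lambda>x. D x v" k] by simp
  then show ?thesis
    using der by (auto simp: differentiable_def)
qed

lemma Ck_on_Suc_imp_Ck_on: "Ck_on (Suc k) S f \<Longrightarrow> Ck_on k S f"
proof (induction k arbitrary: f)
  case 0
  then show ?case
    by (auto intro!: continuous_at_imp_continuous_on differentiable_imp_continuous_within)
next
  case (Suc k)
  then have "\<forall>x\<in>S. f differentiable (at x)" "\<And>v. Ck_on (Suc k) S (\<lambda>x. frechet_derivative f (at x) v)"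
    by simp_all
  with Suc.IH show ?case
    by simp
qed

lemma Ck_on_const: "open S \<Longrightarrow> Ck_on k S (\<lambda>x. c)"
  by (induction k arbitrary: c) (auto intro: Ck_on_SucI[where D = "\<lambda>_ _. 0"])

lemma Ck_on_linear:
  assumes "open S" "bounded_linear f"
  shows "Ck_on k S f"
proof (cases k)
  case 0
  then show ?thesis
    using assms by (simp add: linear_continuous_on)
next
  case (Suc m)
  have "Ck_on (Suc m) S f"
    using assms by (intro Ck_on_SucI[where D = "\<lambda>_. f"] Ck_on_const bounded_linear_imp_has_derivative)
  then show ?thesis
    by (simp only: Suc)
qed

lemma Ck_on_add:
  assumes "open S" "Ck_on k S f" "Ck_on k S g"
  shows "Ck_on k S (\<lambda>x. f x + g x)"
  using assms(2,3)
proof (induction k arbitrary: f g)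
  case (Suc k)
  note f = Ck_on_SucD[OF Suc.prems(1)] and g = Ck_on_SucD[OF Suc.prems(2)]
  show ?case
    by (rule Ck_on_SucI[OF assms(1) has_derivative_add[OF f(1) g(1)] Suc.IH[OF f(2) g(2)]])
qed (auto intro: continuous_intros)

lemma Ck_on_mult:
  fixes f g :: "'a::euclidean_space \<Rightarrow> complex"
  assumes "open S" "Ck_on k S f" "Ck_on k S g"
  shows "Ck_on k S (\<lambda>x. f x * g x)"
  using assms(2,3)
proof (induction k arbitrary: f g)
  case (Suc k)
  note f = Ck_on_SucD[OF Suc.prems(1)] and g = Ck_on_SucD[OF Suc.prems(2)]
  \<comment> \<open>The product rule mixes derivatives with the functions themselves, so the factors
    are needed at level \<open>k\<close> too.\<close>
  have "Ck_on k S f" "Ck_on k S g"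
    using Suc.prems by (blast intro: Ck_on_Suc_imp_Ck_on)+
  then show ?case
    by (intro Ck_on_SucI[OF assms(1) has_derivative_mult[OF f(1) g(1)]]
        Ck_on_add[OF assms(1)] Suc.IH f(2) g(2))
qed (auto intro: continuous_intros)

text \<open>The derivative in direction \<open>v\<close> is \<open>deriv M (z * cnj z)\<close> times
  an expression that is real linear in \<open>z\<close>. The first factor has the original form with
  \<open>deriv M\<close> for \<open>M\<close>, so an induction over all holomorphic \<open>M\<close>
  closes up.\<close>

lemma Ck_on_holomorphic_norm_square:
  assumes V: "open V" and T: "open T" and M: "M holomorphic_on T"
    and VT: "\<And>z. z \<in> V \<Longrightarrow> z * cnj z \<in> T"
  shows "Ck_on k V (\<lambda>z. M (z * cnj z))"
  using M
proof (induction k arbitrary: M)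
  case 0
  have "continuous_on V (M \<circ> (\<lambda>z. z * cnj z))"
    using VT 0 by (intro continuous_on_compose continuous_intros)
      (auto intro: continuous_on_subset holomorphic_on_imp_continuous_on)
  then show ?case
    by (simp add: o_def)
next
  case (Suc k)
  show ?case
  proof (rule Ck_on_SucI[OF V])
    fix z assume "z \<in> V"
    then have "(M has_field_derivative deriv M (z * cnj z)) (at (z * cnj z))"
      using Suc.prems T VT holomorphic_derivI by blast
    then have "(M has_derivative (*) (deriv M (z * cnj z))) (at (z * cnj z))"
      by (simp add: has_field_derivative_def)
    moreover have "((\<lambda>z. z * cnj z) has_derivative (\<lambda>v. z * cnj v + v * cnj z)) (at z)"
      by (auto intro!: derivative_eq_intros)
    ultimately have "(M \<circ> (\<lambda>z. z * cnj z) has_derivative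
        (*) (deriv M (z * cnj z)) \<circ> (\<lambda>v. z * cnj v + v * cnj z)) (at z)"
      by (rule diff_chain_at[rotated])
    then show "((\<lambda>z. M (z * cnj z)) has_derivative
        (\<lambda>v. deriv M (z * cnj z) * (z * cnj v + v * cnj z))) (at z)"
      by (simp add: o_def)
  next
    fix v
    have "Ck_on k V (\<lambda>z. deriv M (z * cnj z))"
      by (intro Suc.IH holomorphic_deriv Suc.prems T)
    moreover have "Ck_on k V (\<lambda>z. z * cnj v + v * cnj z)"
      by (intro Ck_on_linear V bounded_linear_intros bounded_linear_cnj)
    ultimately show "Ck_on k V (\<lambda>z. deriv M (z * cnj z) * (z * cnj v + v * cnj z))"
      by (rule Ck_on_mult[OF V])
  qed
qed

lemma smooth_on_radial_scaling:
  assumes "open V" "open T" "M holomorphic_on T" "\<And>z. z \<in> V \<Longrightarrow> z * cnj z \<in> T"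
  shows "smooth_on V (\<lambda>z. z * M (z * cnj z))"
  unfolding smooth_on_def
  using assms by (intro allI Ck_on_mult Ck_on_holomorphic_norm_square Ck_on_linear bounded_linear_ident)

text \<open>
  Since \<open>G\<close> is real on the reals, \<open>H z = z * G (z * cnj z)\<close> satisfies
  \<open>H z * cnj (H z) = K (z * cnj z)\<close> for \<open>K w = w * (G w)\<^sup>2\<close>. Hence \<open>H\<close> is inverted by dividing by
  \<open>G \<circ> J\<close>, where \<open>J\<close> is a local inverse of \<open>K\<close>.
\<close>

lemma radial_scaling_diffeomorphism:
  assumes e: "0 < e" and hol: "G holomorphic_on ball 0 e" and G0: "G 0 = 1"
    and real: "\<And>w. w \<in> ball 0 e \<Longrightarrow> w \<in> \<real> \<Longrightarrow> G w \<in> \<real>"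
  defines "H \<equiv> \<lambda>z. z * G (z * cnj z)"
  shows "\<exists>U V. 0 \<in> U \<and> 0 \<in> V \<and> smooth_diffeomorphism U V H"
proof -
  define K where "K w = w * (G w)\<^sup>2" for w
  have holK: "K holomorphic_on ball 0 e"
    unfolding K_def by (intro holomorphic_intros hol)
  have "(G has_field_derivative deriv G 0) (at 0)"
    using hol e by (auto intro: holomorphic_derivI[of G "ball 0 e"])
  \<comment> \<open>The derivative of \<open>K\<close> at \<open>0\<close> is
    \<open>(G 0)\<^sup>2 = 1\<close>, which makes \<open>K\<close> injective near
    \<open>0\<close>.\<close>
  then have "(K has_field_derivative 1) (at 0)"
    unfolding K_def by (auto intro!: derivative_eq_intros simp: G0)
  then have "deriv K 0 \<noteq> 0"
    by (simp add: DERIV_imp_deriv)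
  then obtain e1 where e1: "0 < e1" "ball 0 e1 \<subseteq> ball (0::complex) e" "inj_on K (ball 0 e1)"
    using has_complex_derivative_locally_injective[OF holK] e by (metis centre_in_ball open_ball)
  have "isCont G 0"
    using hol e by (meson centre_in_ball continuous_on_eq_continuous_at holomorphic_on_imp_continuous_on open_ball)
  \<comment> \<open>Keeping \<open>G\<close> at distance less than \<open>1\<close> from
    \<open>1\<close> excludes zeros of \<open>G\<close>.\<close>
  then have "\<exists>e2>0. \<forall>w. dist w 0 < e2 \<longrightarrow> dist (G w) (G 0) < 1"
    unfolding continuous_at_eps_delta by (rule allE[of _ 1]) simp
  then obtain e2 where e2: "0 < e2" "\<And>w. cmod w < e2 \<Longrightarrow> cmod (G w - 1) < 1"
    by (auto simp: G0 dist_norm)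
  define e3 where "e3 = min e1 e2"
  define E where "E = ball (0::complex) e3"
  have e3: "0 < e3" and E: "E \<subseteq> ball 0 e1" "E \<subseteq> ball 0 e" "open E"
    using e1 e2 by (auto simp: e3_def E_def)
  have Gnz: "G w \<noteq> 0" if "w \<in> E" for w
    using e2(2)[of w] that by (auto simp: E_def e3_def)
  have holGE: "G holomorphic_on E" and holKE: "K holomorphic_on E" and injK: "inj_on K E"
    using holomorphic_on_subset[OF hol E(2)] holomorphic_on_subset[OF holK E(2)]
      inj_on_subset[OF e1(3) E(1)] by auto
  obtain J where J: "J holomorphic_on K ` E" "\<And>w. w \<in> E \<Longrightarrow> J (K w) = w"
    using holomorphic_has_inverse[OF holKE E(3) injK] by (metis (no_types, lifting))
  have openKE: "open (K ` E)"
    by (rule open_mapping_thm3[OF holKE E(3) injK])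
  have cnjG: "cnj (G w) = G w" if "w \<in> E" "w \<in> \<real>" for w
    using real[of w] that E by (auto simp: Reals_cnj_iff)
  have sq_real: "z * cnj z \<in> \<real>" for z
    by (simp add: Reals_cnj_iff mult.commute)
  have Hsq: "H z * cnj (H z) = K (z * cnj z)" if "z * cnj z \<in> E" for z
    using cnjG[OF that sq_real] by (simp add: H_def K_def power2_eq_square mult_ac)
  \<comment> \<open>The restriction of \<open>K\<close> to the real axis, prepared for the
    intermediate value theorem.\<close>
  define k where "k t = Re (K (of_real t))" for t :: real
  have K_of_real: "K (of_real t) = of_real (k t)" if "\<bar>t\<bar> < e3" for t
  proof -
    have "of_real t \<in> E"
      using that by (simp add: E_def)
    then have "K (of_real t) \<in> \<real>"
      unfolding K_def using real E by (intro Reals_mult Reals_power) auto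
    then show ?thesis
      by (simp add: k_def)
  qed
  define t0 where "t0 = e3 / 2"
  have t0: "0 < t0" "t0 < e3"
    using e3 by (auto simp: t0_def)
  have k0: "k 0 = 0"
    by (simp add: k_def K_def)
  have kt0: "0 < k t0"
  proof -
    have tE: "of_real t0 \<in> E"
      using t0 by (simp add: E_def)
    obtain x where x: "G (of_real t0) = of_real x"
      using real tE E by (meson Reals_cases Reals_of_real subsetD)
    then have "x \<noteq> 0"
      using Gnz[OF tE] by auto
    then show ?thesis
      using t0 by (simp add: k_def K_def x flip: of_real_power)
  qed
  have contk: "continuous_on {0..t0} k"
  proof -
    have "continuous_on {0..t0} (K \<circ> of_real)"
      using t0 by (intro continuous_on_compose continuous_intros
          continuous_on_subset[OF holomorphic_on_imp_continuous_on[OF holKE]]) (auto simp: E_def)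
    then show ?thesis
      unfolding k_def o_def by (intro continuous_intros)
  qed
  \<comment> \<open>The radius is chosen so that \<open>(cmod y)\<^sup>2\<close> lies between
    \<open>k 0 = 0\<close> and \<open>k t0\<close> for every \<open>y\<close> in the disc
    \<open>V\<close> below.\<close>
  define \<rho> where "\<rho> = sqrt (k t0)"
  have \<rho>: "0 < \<rho>" "\<rho>\<^sup>2 = k t0"
    using kt0 by (auto simp: \<rho>_def)
  define W where "W = {z. z * cnj z \<in> E}"
  have W: "open W"
    unfolding W_def using E(3)
    by (intro open_vimage[of E "\<lambda>z. z * cnj z", unfolded vimage_def] continuous_intros)
  have smoothH: "smooth_on W H"
    unfolding H_def by (rule smooth_on_radial_scaling[OF W E(3) holGE]) (simp add: W_def)
  define V where "V = ball (0::complex) \<rho>"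
  define U where "U = W \<inter> H -` V"
  define M where "M w = inverse (G (J w))" for w
  define H' where "H' y = y * M (y * cnj y)" for y
  have "continuous_on W H"
    using smoothH by (auto simp: smooth_on_def dest: spec[of _ 0])
  then have openU: "open U"
    unfolding U_def V_def using W by (intro continuous_open_preimage) auto
  have H'H: "H' (H z) = z" if "z \<in> U" for z
    using that Gnz[of "z * cnj z"] J(2)[of "z * cnj z"]
    by (simp add: U_def W_def H'_def M_def Hsq) (simp add: H_def)
  have HH': "H' y \<in> U \<and> H (H' y) = y \<and> y * cnj y \<in> K ` E" if "y \<in> V" for y
  proof -
    \<comment> \<open>The intermediate value theorem gives a real \<open>t\<close> with
      \<open>k t = (cmod y)\<^sup>2\<close>. Then \<open>J (y * cnj y) = t\<close> and
      \<open>G\<close> is real there, so \<open>H' y\<close> has squared modulus \<open>t\<close>;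
      this makes \<open>H'\<close> a right inverse of \<open>H\<close>.\<close>
    have "(cmod y)\<^sup>2 \<le> \<rho>\<^sup>2"
      using that \<rho> by (intro power_mono) (auto simp: V_def)
    then obtain t where t: "0 \<le> t" "t \<le> t0" "k t = (cmod y)\<^sup>2"
      using IVT'[of k 0 "(cmod y)\<^sup>2" t0] contk k0 \<rho> t0 by auto
    have tE: "of_real t \<in> E"
      using t t0 by (simp add: E_def)
    have Kt: "y * cnj y = K (of_real t)"
      using K_of_real[of t] t t0 by (simp add: complex_norm_square[symmetric])
    have H'y: "H' y = y / G (of_real t)"
      by (simp add: H'_def M_def Kt J(2)[OF tE] divide_inverse)
    have "H' y * cnj (H' y) = (y * cnj y) / (G (of_real t))\<^sup>2"
      unfolding H'y using cnjG[OF tE] by (simp add: power2_eq_square)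
    then have sq: "H' y * cnj (H' y) = of_real t"
      using Gnz[OF tE] by (simp add: Kt K_def)
    have "H (H' y) = H' y * G (H' y * cnj (H' y))"
      by (simp add: H_def)
    also have "\<dots> = y"
      unfolding sq by (simp add: H'y Gnz[OF tE])
    finally have "H (H' y) = y" .
    then show ?thesis
      using sq tE that Kt by (simp add: U_def W_def)
  qed
  have bij: "bij_betw H U V"
    by (rule bij_betw_byWitness[where f' = H']) (use H'H HH' in \<open>auto simp: U_def\<close>)
  \<comment> \<open>On \<open>V\<close> the abstract inverse is the explicit \<open>H'\<close>,
    whose smoothness follows from its radial form.\<close>
  have inv: "inv_into U H y = H' y" if "y \<in> V" for y
    using HH'[OF that] bij by (auto intro: inv_into_f_eq simp: bij_betw_def)
  have "M holomorphic_on K ` E"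
    unfolding M_def using J Gnz
    by (intro holomorphic_intros holomorphic_on_compose_gen[OF J(1) holGE, unfolded o_def]) auto
  then have "smooth_on V H'"
    unfolding H'_def using HH' by (intro smooth_on_radial_scaling[OF _ openKE]) (auto simp: V_def)
  then have "smooth_on V (inv_into U H)"
    using Ck_on_cong[of V "inv_into U H" H'] inv by (simp add: smooth_on_def V_def)
  moreover have "smooth_on U H"
    unfolding H_def by (rule smooth_on_radial_scaling[OF openU E(3) holGE]) (simp add: U_def W_def)
  moreover have "0 \<in> U"
    using e3 \<rho> by (simp add: U_def W_def V_def H_def E_def)
  ultimately show ?thesis
    using openU bij \<rho> by (intro exI[of _ U] exI[of _ V]) (auto simp: smooth_diffeomorphism_def V_def)
qed

section \<open>The asymptotic representative in closed form and its conjugacy\<close>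

theorem proposition1p5:
  fixes f :: "complex \<Rightarrow> complex" and S :: "complex set"
  assumes "open S" and "0 \<in> S" and "f holomorphic_on S"
    and "f 0 = 0"
    and "0 < cmod (deriv f 0)" and "cmod (deriv f 0) < 1"
  shows "(\<exists>!g. generalized_derivative f g) \<and>
    smoothly_conjugate_near_0 (asymptotic_representative f) (\<lambda>z. deriv f 0 * z)"
proof -
  define a where "a = deriv f 0"
  have a: "a \<noteq> 0" "0 < cmod a" "cmod a < 1"
    using assms by (auto simp: a_def)
  obtain R u where R: "0 < R" and holu: "u holomorphic_on ball 0 R"
    and u0: "u 0 = of_real ((cmod a)\<^sup>2)"
    and realu: "\<And>w. w \<in> ball 0 R \<Longrightarrow> w \<in> \<real> \<Longrightarrow> u w \<in> \<real>"
    and rho: "\<And>r. 0 < r \<Longrightarrow> r\<^sup>2 < R \<Longrightarrow> mean_radius f r = r * sqrt (Re (u (of_real (r\<^sup>2))))"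
    using mean_radius_power_series[OF assms(1,2,3)] a unfolding a_def by metis
  have contu: "isCont u 0"
    using holu R by (meson centre_in_ball continuous_on_eq_continuous_at holomorphic_on_imp_continuous_on open_ball)

  \<comment> \<open>Division by \<open>r\<close> leaves the square root of
    \<open>Re (u (r\<^sup>2))\<close>, which is continuous at \<open>0\<close>, where
    \<open>u 0 = (cmod a)\<^sup>2\<close>.\<close>
  have "((\<lambda>r. mean_radius f r / r) \<longlongrightarrow> cmod a) (at_right 0)"
  proof (rule filterlim_cong[THEN iffD2, OF refl refl])
    have "((\<lambda>r. of_real (r\<^sup>2) :: complex) \<longlongrightarrow> of_real (0\<^sup>2)) (at_right 0)"
      by (intro tendsto_intros)
    then have "((\<lambda>r. sqrt (Re (u (of_real (r\<^sup>2))))) \<longlongrightarrow> sqrt (Re (u 0))) (at_right 0)"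
      by (intro tendsto_intros isCont_tendsto_compose[OF contu]) simp
    then show "((\<lambda>r. sqrt (Re (u (of_real (r\<^sup>2))))) \<longlongrightarrow> cmod a) (at_right 0)"
      by (simp add: u0)
    have "mean_radius f r / r = sqrt (Re (u (of_real (r\<^sup>2))))" if "0 < r" "r < sqrt R" for r
    proof -
      have "r\<^sup>2 < (sqrt R)\<^sup>2"
        using that by (intro power_strict_mono) auto
      then show ?thesis
        using rho[of r] that R by simp
    qed
    then show "\<forall>\<^sub>F r in at_right 0. mean_radius f r / r = sqrt (Re (u (of_real (r\<^sup>2))))"
      unfolding eventually_at_right_field using R by (intro exI[of _ "sqrt R"]) auto
  qed
  moreover have "(f has_field_derivative a) (at 0)"
    using assms unfolding a_def by (auto intro: holomorphic_derivI)
  ultimately have gen: "generalized_derivative f g \<longleftrightarrow> g = (\<lambda>z. a / of_real (cmod a) * z)" for g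
    using assms(4) a by (intro generalized_derivative_iff) auto

  have the_gen: "The (generalized_derivative f) = (\<lambda>z. a / of_real (cmod a) * z)"
    by (rule the_equality) (auto simp: gen)

  \<comment> \<open>The midpoint between \<open>(cmod a)\<^sup>2\<close> and \<open>1\<close>. Near
    \<open>0\<close>, \<open>cmod (u w) < \<mu>\<close> makes \<open>P\<close> contract by the
    factor \<open>\<mu>\<close>, while \<open>0 < Re (u w)\<close> keeps \<open>u w\<close> off the
    branch cut of \<open>csqrt\<close>.\<close>
  define \<mu> where "\<mu> = (1 + (cmod a)\<^sup>2) / 2"
  have a2: "0 < (cmod a)\<^sup>2" "(cmod a)\<^sup>2 < 1"
    using a by (auto simp: power_less_one_iff)
  have \<mu>: "0 \<le> \<mu>" "\<mu> < 1" "(cmod a)\<^sup>2 < \<mu>"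
    using a2 by (auto simp: \<mu>_def)
  have u_nhds: "(u \<longlongrightarrow> u 0) (nhds 0)"
    using contu unfolding isCont_def tendsto_at_iff_tendsto_nhds .
  have "((\<lambda>w. Re (u w)) \<longlongrightarrow> (cmod a)\<^sup>2) (nhds 0)" "((\<lambda>w. cmod (u w)) \<longlongrightarrow> (cmod a)\<^sup>2) (nhds 0)"
    using tendsto_Re[OF u_nhds] tendsto_norm[OF u_nhds] unfolding u0 by (simp_all add: norm_power)
  then have "\<forall>\<^sub>F w in nhds 0. 0 < Re (u w) \<and> cmod (u w) < \<mu>"
    using a2(1) \<mu>(3) by (intro eventually_conj order_tendstoD)
  then obtain d0 where d0: "0 < d0" "\<And>w. cmod w < d0 \<Longrightarrow> 0 < Re (u w) \<and> cmod (u w) < \<mu>"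
    unfolding eventually_nhds_metric by auto
  define d where "d = min d0 R"
  have d: "0 < d" "d \<le> R" "\<And>w. cmod w < d \<Longrightarrow> 0 < Re (u w) \<and> cmod (u w) < \<mu>"
    using d0 R by (auto simp: d_def)
  have holud: "u holomorphic_on ball 0 d"
    by (rule holomorphic_on_subset[OF holu]) (use d(2) in auto)
  \<comment> \<open>Division by \<open>cmod a\<close> normalizes \<open>v 0\<close> to
    \<open>1\<close>, as convergence of the infinite product requires.\<close>
  define v where "v w = csqrt (u w) / of_real (cmod a)" for w
  define P where "P w = w * u w" for w
  have sqrt_u: "csqrt (u w) = of_real (sqrt (Re (u w)))" if "w \<in> ball 0 d" "w \<in> \<real>" for w
  proof -
    have "u w \<in> \<real>"
      using that d realu by auto
    then show ?thesis
      using d(3)[of w] that by (simp add: complex_is_Real_iff)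
  qed
  obtain e G where e: "0 < e" "e \<le> d" and holG: "G holomorphic_on ball 0 e" and G0: "G 0 = 1"
    and G: "\<And>w. w \<in> ball 0 e \<Longrightarrow> G w = v w * G (P w)"
    and realG: "\<And>w. w \<in> ball 0 e \<Longrightarrow> w \<in> \<real> \<Longrightarrow> G w \<in> \<real>"
  proof (rule attracting_infinite_product[of d P v \<mu>])
    show "P holomorphic_on ball 0 d"
      unfolding P_def by (intro holomorphic_intros holud)
    show "v holomorphic_on ball 0 d"
      unfolding v_def using d a by (intro holomorphic_intros holud) (force simp: complex_nonpos_Reals_iff)+
    show "cmod (P w) \<le> \<mu> * cmod w" if "w \<in> ball 0 d" for w
      using mult_right_mono[of "cmod (u w)" \<mu> "cmod w"] d(3)[of w] that
      by (simp add: P_def norm_mult mult.commute)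
    show "v 0 = 1"
      using sqrt_u[of 0] d a by (simp add: v_def u0)
    show "P w \<in> \<real>" if "w \<in> ball 0 d" "w \<in> \<real>" for w
      using realu[of w] that d by (auto simp: P_def)
    show "v w \<in> \<real>" if "w \<in> ball 0 d" "w \<in> \<real>" for w
      unfolding v_def sqrt_u[OF that] by (intro Reals_divide Reals_of_real)
  qed (use d \<mu> in auto)

  define H where "H z = z * G (z * cnj z)" for z
  obtain U V where UV: "0 \<in> U" "0 \<in> V" "smooth_diffeomorphism U V H"
    using radial_scaling_diffeomorphism[OF e(1) holG G0 realG] unfolding H_def by blast
  define D where "D z = a * z * v (z * cnj z)" for z
  \<comment> \<open>The factor \<open>cmod z\<close> of the mean radius cancels the denominator of
    \<open>z / cmod z\<close>, so the radius enters only through \<open>u (z * cnj z)\<close>. At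
    \<open>0\<close> both sides have the value \<open>0\<close>.\<close>
  have rep: "asymptotic_representative f z = D z" if "(cmod z)\<^sup>2 < d" for z
  proof (cases "z = 0")
    case False
    have "of_real (sqrt (Re (u (of_real ((cmod z)\<^sup>2))))) = csqrt (u (z * cnj z))"
      using sqrt_u[of "z * cnj z"] that by (simp add: norm_mult power2_eq_square flip: complex_norm_square)
    then show ?thesis
      using False rho[of "cmod z"] that d(2) a
      by (simp add: asymptotic_representative_def the_gen D_def v_def)
  qed (simp add: asymptotic_representative_def D_def)
  \<comment> \<open>With \<open>s = z * cnj z\<close>, realness of \<open>v s\<close> gives
    \<open>D z\<close> the squared modulus \<open>P s\<close>. Then
    \<open>H (D z) = a * z * v s * G (P s)\<close>, and the functional equation merges the last two
    factors into \<open>G s\<close>.\<close>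
  have conj: "H (D z) = a * H z" if "(cmod z)\<^sup>2 < e" for z
  proof -
    define s where "s = z * cnj z"
    have s: "s \<in> ball 0 e" "s \<in> \<real>" "s \<in> ball 0 d"
      using that e by (auto simp: s_def norm_mult power2_eq_square Reals_cnj_iff)
    have "v s \<in> \<real>"
      unfolding v_def sqrt_u[OF s(3,2)] by (intro Reals_divide Reals_of_real)
    then have "D z * cnj (D z) = s * (a * cnj a * (v s)\<^sup>2)"
      by (simp add: D_def Reals_cnj_iff power2_eq_square mult_ac flip: s_def)
    also have "a * cnj a * (v s)\<^sup>2 = u s"
      using a by (simp add: v_def power_divide flip: complex_norm_square)
    finally have "D z * cnj (D z) = P s"
      by (simp add: P_def)
    then show ?thesis
      using G[OF s(1)] by (simp add: H_def D_def flip: s_def)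
  qed
  \<comment> \<open>Continuity of \<open>D\<close> at \<open>0\<close> is what puts
    \<open>D z\<close> into \<open>U\<close> for \<open>z\<close> near \<open>0\<close>.\<close>
  have "isCont v 0"
    unfolding v_def using contu u0 a2 a
    by (intro continuous_intros isCont_o2[OF contu] continuous_at_csqrt) (auto simp: complex_nonpos_Reals_iff)
  then have "isCont D 0"
    unfolding D_def by (intro continuous_intros isCont_o2[of 0 "\<lambda>z. z * cnj z" v]) auto
  then have "(D \<longlongrightarrow> D 0) (nhds 0)"
    unfolding isCont_def tendsto_at_iff_tendsto_nhds .
  then have "\<forall>\<^sub>F z in nhds 0. D z \<in> U"
    by (rule topological_tendstoD) (use UV in \<open>auto simp: D_def smooth_diffeomorphism_def\<close>)
  moreover have "\<forall>\<^sub>F z in nhds 0. z \<in> U"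
    using UV by (auto intro: eventually_nhds_in_open simp: smooth_diffeomorphism_def)
  moreover have "\<forall>\<^sub>F z in nhds 0. (cmod z)\<^sup>2 < e"
    using e(1) by (intro order_tendstoD[of _ 0]) (auto intro!: tendsto_eq_intros simp: filterlim_ident)
  ultimately have "\<forall>\<^sub>F z in nhds 0. z \<in> U \<and> asymptotic_representative f z \<in> U
      \<and> H (asymptotic_representative f z) = a * H z"
  proof eventually_elim
    case (elim z)
    then show ?case
      using rep[of z] conj[of z] e(2) by auto
  qed
  moreover have "H 0 = 0"
    by (simp add: H_def)
  ultimately have "smoothly_conjugate_near_0 (asymptotic_representative f) (\<lambda>z. a * z)"
    using UV unfolding smoothly_conjugate_near_0_def by blast
  then show ?thesis
    by (simp add: gen a_def)
qed

end
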